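(* Let $f(n) := L(n+1) - L(n)$ for positive integers $n$. For every positive integer $n$, if $f(n) > 0$, then $f(n) = 1$. Moreover, $f$ attains every negative value: for every negative integer $m$ there exists a positive integer $n$ such that $f(n) = m$.
   Context: The Fibonacci sequence is defined by $F_0 = 0$, $F_1 = 1$, and $F_n = F_{n-1}+F_{n-2}$ for $n\ge 2$. By Zeckendorf's theorem, every positive integer $n$ can be written uniquely as $n = \sum_{i=1}^{k} F_{c_i}$ with $k \ge 1$, $c_1\ge 2$, and $c_i \ge c_{i-1}+2$ for $2\le i\le k$; this is the Zeckendorf partition of $n$. Let $L(n) := k$ be the number of summands in the Zeckendorf partition of $n$. *)

theory Defs
  imports Complex_Main "HOL-Number_Theory.Fib"
begin

text \<open>
  The list \<open>cs = [c\<^sub>1, \<dots>, c\<^sub>k]\<close> holds the indices of the Fibonacci summands, in increasing order.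
\<close>

definition is_zeckendorf_partition :: "nat \<Rightarrow> nat list \<Rightarrow> bool" where
  "is_zeckendorf_partition n cs \<longleftrightarrow>
     cs \<noteq> [] \<and> 2 \<le> hd cs \<and> successively (\<lambda>a b. a + 2 \<le> b) cs \<and> n = (\<Sum>c\<leftarrow>cs. fib c)"

text \<open>
  By Zeckendorf's theorem the description is proper for \<open>n > 0\<close>; no value is intended at \<open>n = 0\<close>.
\<close>

definition zeckendorf_partition :: "nat \<Rightarrow> nat list" where
  "zeckendorf_partition n = (THE cs. is_zeckendorf_partition n cs)"

definition L :: "nat \<Rightarrow> nat" where
  "L n = length (zeckendorf_partition n)"

definition f :: "nat \<Rightarrow> int" where
  "f n = int (L (n + 1)) - int (L n)"

end

theory Submission
  imports Defs
begin

text \<open>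
  Both claims come from watching what adding \<open>1\<close> does to a Zeckendorf partition.
  The new unit either stays as a separate summand \<open>F\<^sub>2\<close> or merges with the smallest old summand,
  and every merge \<open>F\<^sub>d + F\<^bsub>d+1\<^esub> = F\<^bsub>d+2\<^esub>\<close> replaces two summands by one and pushes the
  possible conflict two places up (\<open>add_fib_carry\<close>). Carries only destroy summands, so
  \<open>L (n + 1) \<le> L n + 1\<close>, which is the first claim. Starting from \<open>1 = F\<^sub>2\<close>, the same carry process
  also produces a partition of every positive integer.

  For the second claim, take a number for which the carry runs through all summands:
  \<open>F\<^sub>3 + F\<^sub>5 + \<dots> + F\<^bsub>2k+1\<^esub> = F\<^bsub>2k+2\<^esub> - 1\<close> has \<open>k\<close> summands, and its successor has only one,
  so \<open>f\<close> takes the value \<open>1 - k\<close> there.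

  To read off \<open>L\<close> from any partition at hand, partitions have to be unique. This holds because
  a sum of non-consecutive Fibonacci numbers stays below the Fibonacci number that follows its
  largest summand (\<open>fib_sum_less\<close>), so the largest index is determined by the sum.
\<close>

section \<open>Uniqueness of Zeckendorf partitions\<close>

text \<open>
  The summands below the largest one \<open>F\<^sub>c\<close> have indices up to \<open>c - 2\<close>, so by induction they add
  up to less than \<open>F\<^bsub>c-1\<^esub> = F\<^bsub>c+1\<^esub> - F\<^sub>c\<close>. If there are none, this needs \<open>F\<^bsub>c-1\<^esub> > 0\<close>, whence the
  lower bound on the indices.
\<close>

lemma fib_sum_less:
  assumes "successively (\<lambda>a b. a + 2 \<le> b) cs" "cs \<noteq> []" "2 \<le> hd cs"
  shows "(\<Sum>c\<leftarrow>cs. fib c) < fib (Suc (last cs))"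
  using assms
proof (induction cs rule: rev_induct)
  case (snoc c cs)
  have "2 \<le> c \<and> (\<Sum>c\<leftarrow>cs. fib c) < fib (c - 1)"
  proof (cases "cs = []")
    case True
    then show ?thesis
      using snoc.prems by (simp add: fib_neq_0_nat)
  next
    case False
    then have less: "(\<Sum>c\<leftarrow>cs. fib c) < fib (Suc (last cs))" and gap: "last cs + 2 \<le> c"
      using snoc by (auto simp: successively_append_iff)
    have "fib (Suc (last cs)) \<le> fib (c - 1)"
      using gap by (intro fib_mono) simp
    then show ?thesis
      using less gap by simp
  qed
  moreover have "fib (Suc c) = fib c + fib (c - 1)" if "2 \<le> c"
    using that by (cases c) simp_all
  ultimately show ?case
    by simp
qed simp

lemma zeckendorf_partition_unique:
  assumes "is_zeckendorf_partition n cs" "is_zeckendorf_partition n ds"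
  shows "cs = ds"
proof -
  \<comment> \<open>Empty lists are admitted so that the induction can remove the last index.\<close>
  define zeck where
    "zeck = (\<lambda>cs :: nat list. successively (\<lambda>a b. a + 2 \<le> b) cs \<and> (cs \<noteq> [] \<longrightarrow> 2 \<le> hd cs))"
  have zeck_butlast: "zeck cs" if "zeck (cs @ [c])" for cs c
    using that by (auto simp: zeck_def successively_append_iff)
  have zeck_zero: "cs = []" if "zeck cs" "(\<Sum>c\<leftarrow>cs. fib c) = 0" for cs
  proof (rule ccontr)
    assume "cs \<noteq> []"
    then have "0 < fib (hd cs)" "hd cs \<in> set cs"
      using that(1) by (auto simp: zeck_def intro!: fib_neq_0_nat)
    then show False
      using that(2) by simp
  qed
  have last_le: "c \<le> d"
    if "zeck (cs @ [c])" "zeck (ds @ [d])"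
      "(\<Sum>c\<leftarrow>cs @ [c]. fib c) = (\<Sum>d\<leftarrow>ds @ [d]. fib d)" for cs ds c d
  proof (rule ccontr)
    assume "\<not> c \<le> d"
    then have "fib (Suc d) \<le> fib c"
      by (intro fib_mono) simp
    moreover have "(\<Sum>d\<leftarrow>ds @ [d]. fib d) < fib (Suc d)"
      using fib_sum_less[of "ds @ [d]"] that(2) by (simp add: zeck_def)
    ultimately show False
      using that(3) by simp
  qed
  have "cs = ds" if "zeck cs" "zeck ds" "(\<Sum>c\<leftarrow>cs. fib c) = (\<Sum>d\<leftarrow>ds. fib d)" for cs ds
    using that
  proof (induction cs arbitrary: ds rule: rev_induct)
    case Nil
    then show ?case
      using zeck_zero[of ds] by simp
  next
    case (snoc c cs)
    obtain ds' d where ds: "ds = ds' @ [d]"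
      using snoc.prems zeck_zero[of "cs @ [c]"] by (cases ds rule: rev_cases) auto
    have "c = d"
      using last_le[of cs c ds' d] last_le[of ds' d cs c] snoc.prems ds by simp
    moreover have "cs = ds'"
      using snoc.prems ds \<open>c = d\<close> zeck_butlast by (intro snoc.IH) auto
    ultimately show ?case
      using ds by simp
  qed
  then show ?thesis
    using assms by (simp add: is_zeckendorf_partition_def zeck_def)
qed

lemma L_eq_length:
  assumes "is_zeckendorf_partition n cs"
  shows "L n = length cs"
proof -
  have "zeckendorf_partition n = cs"
    unfolding zeckendorf_partition_def
    using assms zeckendorf_partition_unique by (intro the_equality)
  then show ?thesis
    by (simp add: L_def)
qed

section \<open>Adding one\<close>

text \<open>
  The condition \<open>d < hd cs\<close> allows the one conflict \<open>hd cs = d + 1\<close>. Merging then yields \<open>F\<^bsub>d+2\<^esub>\<close>,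
  while the next index is at least \<open>d + 3\<close>: the same situation with a shorter list.
\<close>

lemma add_fib_carry:
  assumes "successively (\<lambda>a b. a + 2 \<le> b) cs" "cs \<noteq> [] \<Longrightarrow> d < hd cs"
  shows "\<exists>ds. ds \<noteq> [] \<and> d \<le> hd ds \<and> successively (\<lambda>a b. a + 2 \<le> b) ds \<and>
    (\<Sum>c\<leftarrow>ds. fib c) = fib d + (\<Sum>c\<leftarrow>cs. fib c) \<and> length ds \<le> Suc (length cs)"
  using assms
proof (induction cs arbitrary: d)
  case Nil
  show ?case
    by (intro exI[of _ "[d]"]) simp
next
  case (Cons c cs)
  show ?case
  proof (cases "c = Suc d")
    case True
    have "successively (\<lambda>a b. a + 2 \<le> b) cs" "cs \<noteq> [] \<Longrightarrow> d + 2 < hd cs"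
      using Cons.prems True by (auto simp: successively_Cons)
    from Cons.IH[OF this] show ?thesis
      using True by force
  next
    case False
    then show ?thesis
      using Cons.prems by (intro exI[of _ "d # c # cs"]) auto
  qed
qed

lemma zeckendorf_partition_add_one:
  assumes "is_zeckendorf_partition n cs"
  shows "\<exists>ds. is_zeckendorf_partition (n + 1) ds \<and> length ds \<le> Suc (length cs)"
proof -
  obtain c cs' where cs: "cs = c # cs'"
    using assms by (cases cs) (auto simp: is_zeckendorf_partition_def)
  show ?thesis
  proof (cases "c = 2")
    case True
    \<comment> \<open>A second unit cannot be written as another \<open>F\<^sub>2\<close>; here \<open>1 + F\<^sub>2 = F\<^sub>3\<close> enters instead.\<close>
    have "successively (\<lambda>a b. a + 2 \<le> b) cs'" "cs' \<noteq> [] \<Longrightarrow> 3 < hd cs'"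
      using assms cs True by (auto simp: is_zeckendorf_partition_def successively_Cons)
    from add_fib_carry[OF this] show ?thesis
      using assms cs True by (fastforce simp: is_zeckendorf_partition_def numeral_eq_Suc)
  next
    case False
    have "successively (\<lambda>a b. a + 2 \<le> b) cs" "cs \<noteq> [] \<Longrightarrow> 2 < hd cs"
      using assms cs False by (auto simp: is_zeckendorf_partition_def)
    from add_fib_carry[OF this] show ?thesis
      using assms by (auto simp: is_zeckendorf_partition_def)
  qed
qed

lemma zeckendorf_partition_exists:
  assumes "0 < n"
  shows "\<exists>cs. is_zeckendorf_partition n cs"
  using assms
proof (induction n rule: nat_induct_non_zero)
  case 1
  show ?case
    by (intro exI[of _ "[2]"]) (simp add: is_zeckendorf_partition_def)
next
  case (Suc n)
  then show ?case
    using zeckendorf_partition_add_one by fastforce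
qed

lemma L_add_one_le:
  assumes "0 < n"
  shows "L (n + 1) \<le> L n + 1"
proof -
  obtain cs where cs: "is_zeckendorf_partition n cs"
    using zeckendorf_partition_exists assms by blast
  obtain ds where "is_zeckendorf_partition (n + 1) ds" "length ds \<le> Suc (length cs)"
    using zeckendorf_partition_add_one[OF cs] by blast
  then show ?thesis
    using cs by (simp add: L_eq_length)
qed

section \<open>Long carries\<close>

lemma sum_odd_fib:
  "(\<Sum>c\<leftarrow>map (\<lambda>i. 2 * i + 3) [0..<k]. fib c) + 1 = fib (2 * k + 2)"
  by (induction k) (simp_all add: numeral_eq_Suc)

lemma f_fib_minus_one:
  assumes "0 < k"
  shows "f (fib (2 * k + 2) - 1) = 1 - int k"
proof -
  let ?cs = "map (\<lambda>i. 2 * i + 3) [0..<k]"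
  have "successively (\<lambda>a b. a + 2 \<le> b) ?cs"
    by (auto simp: successively_conv_nth)
  moreover have "?cs \<noteq> []" "2 \<le> hd ?cs"
    using assms by (simp_all add: hd_map)
  moreover have "fib (2 * k + 2) - 1 = (\<Sum>c\<leftarrow>?cs. fib c)"
    by (simp only: sum_odd_fib[symmetric] add_diff_cancel_right')
  ultimately have "is_zeckendorf_partition (fib (2 * k + 2) - 1) ?cs"
    unfolding is_zeckendorf_partition_def by blast
  moreover have "is_zeckendorf_partition (fib (2 * k + 2)) [2 * k + 2]"
    by (simp add: is_zeckendorf_partition_def)
  moreover have "fib (2 * k + 2) - 1 + 1 = fib (2 * k + 2)"
    by (simp only: sum_odd_fib[symmetric] add_diff_cancel_right')
  ultimately show ?thesis
    by (simp only: f_def L_eq_length) simp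
qed

theorem theorem1p4:
  shows "(\<forall>n::nat. n > 0 \<longrightarrow> f n > 0 \<longrightarrow> f n = 1) \<and>
         (\<forall>m::int. m < 0 \<longrightarrow> (\<exists>n::nat. n > 0 \<and> f n = m))"
proof (intro conjI allI impI)
  fix n :: nat
  assume "n > 0" "f n > 0"
  then show "f n = 1"
    using L_add_one_le[of n] by (simp add: f_def)
next
  fix m :: int
  assume "m < 0"
  define k where "k = nat (1 - m)"
  have k: "0 < k" "1 - int k = m"
    using \<open>m < 0\<close> by (simp_all add: k_def)
  have "fib 4 \<le> fib (2 * k + 2)"
    using k(1) by (intro fib_mono) simp
  then have "fib (2 * k + 2) - 1 > 0"
    by (simp add: numeral_eq_Suc)
  then show "\<exists>n::nat. n > 0 \<and> f n = m"
    using f_fib_minus_one[OF k(1)] k(2) by blast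
qed

end
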